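(* Let $m\ge1$, and let $\hat{\mathcal B}(C)=\hat{\mathcal B}((C^-,C^+))=\{\hat\lambda_j\}_{j=1}^{(m+1)^2}$ be a basis of the local immersed finite element space $\hat{\mathcal V}^m_\beta(\hat K_F)$ (notation as in the context). Let $\{(\mathbf x_r,w_r)\}_{r=1}^{N}$ be the quadrature nodes and weights described in the context, with $\hat{\mathbf x}_r=R_\Gamma(\mathbf x_r)$. Let $W=\operatorname{diag}(w_1,\dots,w_N)$, let $V$ be the $N\times(m+1)^2$ generalized Vandermonde matrix $V_{r,j}=\hat\lambda_j(\hat{\mathbf x}_r)$, and let $\tilde V=\sqrt W\,V$, so that the approximate mass matrix factors as $M_q(\hat{\mathcal B}(C))=V^TWV=\tilde V^T\tilde V$. Assume $N\ge(m+1)^2$, and let $\tilde V=U_2\Sigma V_2^T$ be an economy singular value decomposition, where $U_2$ is $N\times(m+1)^2$ and $\Sigma$, $V_2$ are $(m+1)^2\times(m+1)^2$. Put $Q_2=V_2\Sigma^{-1}$. Then $\hat{\mathcal B}((C^-Q_2,\,C^+Q_2))$ is another basis of $\hat{\mathcal V}^m_\beta(\hat K_F)$, and its approximate mass matrix is the identity: $$M_q\big(\hat{\mathcal B}((C^-Q_2,C^+Q_2))\big)=Q_2^TM_q(\hat{\mathcal B}(C))Q_2=I_{(m+1)^2}.$$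
   Context: Geometry. Let $\mathbf g:[\xi_s,\xi_e]\to\mathbb R^2$ be a regular $C^3$ parametrization of a plane curve $\Gamma$ (the interface), with unit tangent $\boldsymbol\tau=\mathbf g'/\|\mathbf g'\|$, unit normal $\mathbf n=\begin{bmatrix}0&1\\-1&0\end{bmatrix}\boldsymbol\tau$, and curvature $\kappa(\xi)=\|\mathbf g'(\xi)\|^{-3}\det[\mathbf g'(\xi),\mathbf g''(\xi)]$. Let $P_\Gamma(\eta,\xi)=\mathbf g(\xi)+\eta\,\mathbf n(\xi)$; on a tubular neighborhood of $\Gamma$ it has an inverse $R_\Gamma$. Let $K$ be a rectangular mesh element of diameter $h$ whose interior meets $\Gamma$ (an interface element), with $h$ small enough that $K$ lies in this tubular neighborhood, and let $\hat K_F=[-h,h]\times[\xi_0,\xi_1]$, with $[\xi_0,\xi_1]\subset[\xi_s,\xi_e]$, be a rectangle on which $P_\Gamma$ is injective and such that $K\subset P_\Gamma(\hat K_F)$. Points of $\hat K_F$ are written $(\eta,\xi)$. Put $\hat K_F^{+}=\{(\eta,\xi)\in\hat K_F:\eta>0\}$, $\hat K_F^{-}=\{(\eta,\xi)\in\hat K_F:\eta<0\}$, and $K^\pm=K\cap P_\Gamma(\hat K_F^\pm)$. Let $\beta^+,\beta^->0$ be constants. Laplacian in local coordinates. With $\psi(\eta,\xi)=\frac1{1+\eta\kappa(\xi)}$ and $\rho(\eta,\xi)=\|\mathbf g'(\xi)\|^{-1}\psi(\eta,\xi)$, define $$\mathscr L(\hat u)=\hat u_{\eta\eta}+J_0\hat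 u_{\xi\xi}+J_1\hat u_\eta+J_2\hat u_\xi,$$ $$J_0=\rho^2,\qquad J_1=\kappa\,\psi,\qquad J_2=-\rho^2\Big(\eta\,\kappa'(\xi)\,\psi+\frac{\mathbf g'(\xi)\cdot\mathbf g''(\xi)}{\|\mathbf g'(\xi)\|^2}\Big).$$ Spaces. $\mathbb P_m$ is the space of real univariate polynomials of degree at most $m$; $\mathbb Q_m$ is the space of real polynomials in $(\eta,\xi)$ of degree at most $m$ in each variable. $\hat{\mathcal V}^m_\beta(\hat K_F)$ is the real vector space, of dimension $(m+1)^2$, of functions $\hat\phi$ on $\hat K_F$ such that $\hat\phi|_{\hat K_F^\pm}=\hat\phi^\pm$ with $\hat\phi^\pm\in\mathbb Q_m$, satisfying (i) $\hat\phi^+(0,\xi)=\hat\phi^-(0,\xi)$ for $\xi\in[\xi_0,\xi_1]$; (ii) $\beta^+\hat\phi^+_\eta(0,\xi)=\beta^-\hat\phi^-_\eta(0,\xi)$ for $\xi\in[\xi_0,\xi_1]$; (iii) $\beta^+\int_{\xi_0}^{\xi_1}\frac{\partial^j}{\partial\eta^j}\mathscr L(\hat\phi^+)(0,\xi)\,v(\xi)\,d\xi=\beta^-\int_{\xi_0}^{\xi_1}\frac{\partial^j}{\partial\eta^j}\mathscr L(\hat\phi^-)(0,\xi)\,v(\xi)\,d\xi$ for all $v\in\mathbb P_m$ and all integers $0\le j\le m-2$. Polynomial basis. Let $p_i$ be the Legendre polynomial of degree $i$, $q_0(x)=1$, $q_1(x)=p_1(x)=x$, and $q_i(x)=(2i-1)x\,p_{i-1}(x)-(2i-1)p_{i-1}(0)\,x$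 for $2\le i\le m$. Write $(\eta_i,\xi_i^A)=R_\Gamma(A_i)$ for the vertices $A_1,\dots,A_4$ of $K$; take $\xi_0=\min_i\xi_i^A$, $\xi_1=\max_i\xi_i^A$, $\eta_h=\max_i|\eta_i|$, $\xi^{\mathrm{mid}}=\frac12(\xi_0+\xi_1)$, $\xi_h=\frac12(\xi_1-\xi_0)$, and $$\mathcal R_{(m+1)t+s+1}(\eta,\xi)=q_t\Big(\frac{\eta}{\eta_h}\Big)\,p_s\Big(\frac{\xi-\xi^{\mathrm{mid}}}{\xi_h}\Big),\qquad 0\le s,t\le m,$$ which gives a basis $\{\mathcal R_i\}_{i=1}^{(m+1)^2}$ of $\mathbb Q_m$. The family $\hat{\mathcal B}$. For real $(m+1)^2\times(m+1)^2$ matrices $C^\pm=(C^\pm_{i,j})$, $\hat{\mathcal B}((C^-,C^+))=\{\hat\lambda_j\}_{j=1}^{(m+1)^2}$, where $$\hat\lambda_j(\eta,\xi)=\sum_{i=1}^{(m+1)^2}C^-_{i,j}\mathcal R_i(\eta,\xi)\ \text{ for }\eta<0,\qquad \hat\lambda_j(\eta,\xi)=\sum_{i=1}^{(m+1)^2}C^+_{i,j}\mathcal R_i(\eta,\xi)\ \text{ for }\eta>0.$$ Quadrature and approximate mass matrix. Let $\{(\mathbf x_k^{\pm},w_k^{\pm})\}_{k=1}^{N^\pm}$ be the nodes and weights of chosen quadrature rules on $K^\pm$, let $N=N^-+N^+$, let $\{(\mathbf x_r,w_r)\}_{r=1}^N$ be the union of the two rules, and $\hat{\mathbf x}_r=R_\Gamma(\mathbf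 x_r)$. For a family $\hat{\mathcal B}=\{\hat\lambda_j\}_{j=1}^{(m+1)^2}$ the approximate mass matrix is $$M_q(\hat{\mathcal B})=\Big(\sum_{r=1}^N w_r\,\hat\lambda_i(\hat{\mathbf x}_r)\,\hat\lambda_j(\hat{\mathbf x}_r)\Big)_{i,j=1}^{(m+1)^2},$$ where at a node coming from $K^\pm$ the $\pm$ piece of $\hat\lambda_j$ is used; it is the quadrature approximation of $\Big(\int_K(\hat\lambda_i\circ R_\Gamma)(\hat\lambda_j\circ R_\Gamma)\,dx\,dy\Big)_{i,j=1}^{(m+1)^2}$.
   Formalization: The condition N ≥ (m+1)² does not guarantee that Σ is invertible (e.g. coinciding nodes), so the invertibility of Σ, needed for Q_2 = V_2 Σ^{-1}, is assumed; the quadrature weights are assumed nonnegative so that √W is a real matrix. *)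

theory Defs
  imports
    "HOL-Analysis.Analysis"
    "HOL-Computational_Algebra.Polynomial"
    "HOL-Library.Function_Algebras"
    "Jordan_Normal_Form.Matrix"
begin

section \<open>Functions as a real vector space\<close>

text \<open>With this instance the library notions \<^const>\<open>independent\<close> and \<^const>\<open>span\<close> apply to
  spaces of functions.\<close>

instantiation "fun" :: (type, real_vector) real_vector
begin

definition scaleR_fun_def: "scaleR c f = (\<lambda>x. c *\<^sub>R f x)"

instance
  by standard (simp_all add: scaleR_fun_def plus_fun_def fun_eq_iff scaleR_add_right scaleR_add_left)

end

definition basis_family :: "nat \<Rightarrow> (nat \<Rightarrow> 'a::real_vector) \<Rightarrow> 'a set \<Rightarrow> bool" where
  "basis_family n b S \<longleftrightarrow>
     inj_on b {..<n} \<and> independent (b ` {..<n}) \<and> span (b ` {..<n}) = S"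

section \<open>Geometry of the interface\<close>

text \<open>The curve is only given on a closed interval \<open>I\<close>, so its derivatives are taken within \<open>I\<close>
  (one-sided at the end points).\<close>

definition deriv_on :: "real set \<Rightarrow> (real \<Rightarrow> 'a::real_normed_vector) \<Rightarrow> real \<Rightarrow> 'a" where
  "deriv_on I f x = vector_derivative f (at x within I)"

definition Ck_on :: "nat \<Rightarrow> real set \<Rightarrow> (real \<Rightarrow> 'a::real_normed_vector) \<Rightarrow> bool" where
  "Ck_on k I f \<longleftrightarrow>
     (\<forall>i<k. (deriv_on I ^^ i) f differentiable_on I) \<and> continuous_on I ((deriv_on I ^^ k) f)"

definition regular_C3_curve :: "real \<Rightarrow> real \<Rightarrow> (real \<Rightarrow> real \<times> real) \<Rightarrow> bool" where
  "regular_C3_curve a b g \<longleftrightarrow>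
     a < b \<and> Ck_on 3 {a..b} g \<and> (\<forall>x\<in>{a..b}. deriv_on {a..b} g x \<noteq> 0)"

definition unit_tangent :: "real set \<Rightarrow> (real \<Rightarrow> real \<times> real) \<Rightarrow> real \<Rightarrow> real \<times> real" where
  "unit_tangent I g x = deriv_on I g x /\<^sub>R norm (deriv_on I g x)"

definition unit_normal :: "real set \<Rightarrow> (real \<Rightarrow> real \<times> real) \<Rightarrow> real \<Rightarrow> real \<times> real" where
  "unit_normal I g x = (snd (unit_tangent I g x), - fst (unit_tangent I g x))"

definition curvature :: "real set \<Rightarrow> (real \<Rightarrow> real \<times> real) \<Rightarrow> real \<Rightarrow> real" where
  "curvature I g x =
     (let g1 = deriv_on I g x; g2 = deriv_on I (deriv_on I g) x
      in (fst g1 * snd g2 - fst g2 * snd g1) / norm g1 ^ 3)"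

text \<open>Local coordinates are written as pairs \<open>(\<eta>, \<xi>)\<close>.\<close>

definition P_map :: "real set \<Rightarrow> (real \<Rightarrow> real \<times> real) \<Rightarrow> real \<times> real \<Rightarrow> real \<times> real" where
  "P_map I g = (\<lambda>(\<eta>, \<xi>). g \<xi> + \<eta> *\<^sub>R unit_normal I g \<xi>)"

text \<open>The inverse of \<^const>\<open>P_map\<close> on the tubular neighbourhood of half-width \<open>\<epsilon>\<close>.\<close>

definition R_map :: "real \<Rightarrow> real set \<Rightarrow> (real \<Rightarrow> real \<times> real) \<Rightarrow> real \<times> real \<Rightarrow> real \<times> real" where
  "R_map \<epsilon> I g = inv_into ({-\<epsilon>..\<epsilon>} \<times> I) (P_map I g)"

definition rectangle_vertices :: "(nat \<Rightarrow> real \<times> real) \<Rightarrow> bool" where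
  "rectangle_vertices A \<longleftrightarrow>
     A 2 - A 1 = A 3 - A 4 \<and> inner (A 2 - A 1) (A 4 - A 1) = 0 \<and> A 1 \<noteq> A 2 \<and> A 1 \<noteq> A 4"

definition Khat :: "real \<Rightarrow> real \<Rightarrow> real \<Rightarrow> (real \<times> real) set" where
  "Khat h \<xi>0 \<xi>1 = {-h..h} \<times> {\<xi>0..\<xi>1}"

definition Khat_plus :: "real \<Rightarrow> real \<Rightarrow> real \<Rightarrow> (real \<times> real) set" where
  "Khat_plus h \<xi>0 \<xi>1 = {p \<in> Khat h \<xi>0 \<xi>1. fst p > 0}"

definition Khat_minus :: "real \<Rightarrow> real \<Rightarrow> real \<Rightarrow> (real \<times> real) set" where
  "Khat_minus h \<xi>0 \<xi>1 = {p \<in> Khat h \<xi>0 \<xi>1. fst p < 0}"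

section \<open>The Laplacian in local coordinates\<close>

definition psi :: "real set \<Rightarrow> (real \<Rightarrow> real \<times> real) \<Rightarrow> real \<Rightarrow> real \<Rightarrow> real" where
  "psi I g \<eta> \<xi> = 1 / (1 + \<eta> * curvature I g \<xi>)"

definition rho :: "real set \<Rightarrow> (real \<Rightarrow> real \<times> real) \<Rightarrow> real \<Rightarrow> real \<Rightarrow> real" where
  "rho I g \<eta> \<xi> = psi I g \<eta> \<xi> / norm (deriv_on I g \<xi>)"

definition J0 :: "real set \<Rightarrow> (real \<Rightarrow> real \<times> real) \<Rightarrow> real \<Rightarrow> real \<Rightarrow> real" where
  "J0 I g \<eta> \<xi> = (rho I g \<eta> \<xi>)\<^sup>2"

definition J1 :: "real set \<Rightarrow> (real \<Rightarrow> real \<times> real) \<Rightarrow> real \<Rightarrow> real \<Rightarrow> real" where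
  "J1 I g \<eta> \<xi> = curvature I g \<xi> * psi I g \<eta> \<xi>"

definition J2 :: "real set \<Rightarrow> (real \<Rightarrow> real \<times> real) \<Rightarrow> real \<Rightarrow> real \<Rightarrow> real" where
  "J2 I g \<eta> \<xi> =
     - ((rho I g \<eta> \<xi>)\<^sup>2 *
        (\<eta> * deriv_on I (curvature I g) \<xi> * psi I g \<eta> \<xi>
         + inner (deriv_on I g \<xi>) (deriv_on I (deriv_on I g) \<xi>) / (norm (deriv_on I g \<xi>))\<^sup>2))"

definition d_eta :: "(real \<times> real \<Rightarrow> real) \<Rightarrow> real \<times> real \<Rightarrow> real" where
  "d_eta u = (\<lambda>(\<eta>, \<xi>). deriv (\<lambda>t. u (t, \<xi>)) \<eta>)"

definition d_xi :: "(real \<times> real \<Rightarrow> real) \<Rightarrow> real \<times> real \<Rightarrow> real" where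
  "d_xi u = (\<lambda>(\<eta>, \<xi>). deriv (\<lambda>t. u (\<eta>, t)) \<xi>)"

definition laplacian ::
  "real set \<Rightarrow> (real \<Rightarrow> real \<times> real) \<Rightarrow> (real \<times> real \<Rightarrow> real) \<Rightarrow> real \<times> real \<Rightarrow> real" where
  "laplacian I g u = (\<lambda>(\<eta>, \<xi>).
     d_eta (d_eta u) (\<eta>, \<xi>) + J0 I g \<eta> \<xi> * d_xi (d_xi u) (\<eta>, \<xi>)
     + J1 I g \<eta> \<xi> * d_eta u (\<eta>, \<xi>) + J2 I g \<eta> \<xi> * d_xi u (\<eta>, \<xi>))"

section \<open>The local immersed finite element space\<close>

text \<open>Elements of \<open>\<rat>\<^sub>m\<close> are regarded as polynomial functions on the whole plane.\<close>

definition Q_space :: "nat \<Rightarrow> (real \<times> real \<Rightarrow> real) set" where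
  "Q_space m = {\<lambda>(\<eta>, \<xi>). \<Sum>i\<le>m. \<Sum>j\<le>m. a i j * \<eta> ^ i * \<xi> ^ j | a :: nat \<Rightarrow> nat \<Rightarrow> real. True}"

text \<open>A piecewise function is given by its two pieces, the minus piece first.  As a function on a
  set \<open>S\<close> of local coordinates it is extended by zero outside \<open>S\<close>, so that equality of functions on
  \<open>S\<close> is equality.  On \<open>\<eta> = 0\<close> the plus piece is taken; for members of the space below the two
  pieces agree there.\<close>

type_synonym pieces = "(real \<times> real \<Rightarrow> real) \<times> (real \<times> real \<Rightarrow> real)"

definition glue :: "(real \<times> real) set \<Rightarrow> pieces \<Rightarrow> real \<times> real \<Rightarrow> real" where
  "glue S = (\<lambda>(um, up) p. if p \<in> S then (if fst p < 0 then um p else up p) else 0)"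

definition ife_space ::
  "real set \<Rightarrow> (real \<Rightarrow> real \<times> real) \<Rightarrow> real \<Rightarrow> real \<Rightarrow> nat \<Rightarrow> real \<Rightarrow> real \<Rightarrow> real
     \<Rightarrow> (real \<times> real \<Rightarrow> real) set" where
  "ife_space I g \<beta>m \<beta>p m h \<xi>0 \<xi>1 =
     {glue (Khat h \<xi>0 \<xi>1) (um, up) | um up.
        um \<in> Q_space m \<and> up \<in> Q_space m \<and>
        (\<forall>\<xi>\<in>{\<xi>0..\<xi>1}. up (0, \<xi>) = um (0, \<xi>)) \<and>
        (\<forall>\<xi>\<in>{\<xi>0..\<xi>1}. \<beta>p * d_eta up (0, \<xi>) = \<beta>m * d_eta um (0, \<xi>)) \<and>
        (\<forall>v :: real poly. \<forall>j. degree v \<le> m \<and> j + 2 \<le> m \<longrightarrow>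
           \<beta>p * integral {\<xi>0..\<xi>1}
                  (\<lambda>\<xi>. (deriv ^^ j) (\<lambda>\<eta>. laplacian I g up (\<eta>, \<xi>)) 0 * poly v \<xi>) =
           \<beta>m * integral {\<xi>0..\<xi>1}
                  (\<lambda>\<xi>. (deriv ^^ j) (\<lambda>\<eta>. laplacian I g um (\<eta>, \<xi>)) 0 * poly v \<xi>))}"

section \<open>Polynomial basis and the piecewise family\<close>

text \<open>Rodrigues' formula.\<close>

definition legendre :: "nat \<Rightarrow> real poly" where
  "legendre i = Polynomial.smult (1 / (2 ^ i * fact i)) ((pderiv ^^ i) ([:-1, 0, 1:] ^ i))"

definition q_poly :: "nat \<Rightarrow> real \<Rightarrow> real" where
  "q_poly i x =
     (if i = 0 then 1
      else if i = 1 then x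
      else (2 * real i - 1) * x * poly (legendre (i - 1)) x
           - (2 * real i - 1) * poly (legendre (i - 1)) 0 * x)"

text \<open>Indices are zero-based: index \<open>(m + 1) t + s\<close> below \<open>(m + 1)\<^sup>2\<close> stands for the one-based
  index \<open>(m + 1) t + s + 1\<close>.\<close>

definition R_basis ::
  "nat \<Rightarrow> real \<Rightarrow> real \<Rightarrow> real \<Rightarrow> nat \<Rightarrow> real \<times> real \<Rightarrow> real" where
  "R_basis m \<eta>h \<xi>0 \<xi>1 i = (\<lambda>(\<eta>, \<xi>).
     let t = i div (m + 1); s = i mod (m + 1); \<xi>mid = (\<xi>0 + \<xi>1) / 2; \<xi>h = (\<xi>1 - \<xi>0) / 2
     in q_poly t (\<eta> / \<eta>h) * poly (legendre s) ((\<xi> - \<xi>mid) / \<xi>h))"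

definition B_family ::
  "nat \<Rightarrow> real \<Rightarrow> real \<Rightarrow> real \<Rightarrow> real mat \<times> real mat \<Rightarrow> nat \<Rightarrow> pieces" where
  "B_family m \<eta>h \<xi>0 \<xi>1 C j =
     ((\<lambda>p. \<Sum>i<(m + 1)\<^sup>2. fst C $$ (i, j) * R_basis m \<eta>h \<xi>0 \<xi>1 i p),
      (\<lambda>p. \<Sum>i<(m + 1)\<^sup>2. snd C $$ (i, j) * R_basis m \<eta>h \<xi>0 \<xi>1 i p))"

section \<open>Quadrature, mass matrix and singular value decomposition\<close>

text \<open>The union of a minus rule with \<open>Nm\<close> entries and a plus rule, the minus rule first.\<close>

definition rule_union :: "nat \<Rightarrow> (nat \<Rightarrow> 'a) \<Rightarrow> (nat \<Rightarrow> 'a) \<Rightarrow> nat \<Rightarrow> 'a" where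
  "rule_union Nm fm fp r = (if r < Nm then fm r else fp (r - Nm))"

text \<open>Value of a piecewise function at node number \<open>r\<close>, with the piece chosen by the origin of
  the node.\<close>

definition node_value :: "nat \<Rightarrow> (nat \<Rightarrow> real \<times> real) \<Rightarrow> pieces \<Rightarrow> nat \<Rightarrow> real" where
  "node_value Nm xh u r = (if r < Nm then fst u (xh r) else snd u (xh r))"

definition mass_matrix ::
  "nat \<Rightarrow> nat \<Rightarrow> nat \<Rightarrow> (nat \<Rightarrow> real \<times> real) \<Rightarrow> (nat \<Rightarrow> real) \<Rightarrow> (nat \<Rightarrow> pieces) \<Rightarrow> real mat" where
  "mass_matrix n Nm Np xh w B =
     Matrix.mat n n (\<lambda>(i, j). \<Sum>r<Nm + Np. w r * node_value Nm xh (B i) r * node_value Nm xh (B j) r)"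

definition vandermonde ::
  "nat \<Rightarrow> nat \<Rightarrow> nat \<Rightarrow> (nat \<Rightarrow> real \<times> real) \<Rightarrow> (nat \<Rightarrow> pieces) \<Rightarrow> real mat" where
  "vandermonde n Nm Np xh B = Matrix.mat (Nm + Np) n (\<lambda>(r, j). node_value Nm xh (B j) r)"

text \<open>No ordering of the singular values is required.\<close>

definition economy_svd :: "nat \<Rightarrow> nat \<Rightarrow> real mat \<Rightarrow> real mat \<Rightarrow> real mat \<Rightarrow> real mat \<Rightarrow> bool" where
  "economy_svd N n A U \<Sigma> V \<longleftrightarrow>
     A \<in> carrier_mat N n \<and> U \<in> carrier_mat N n \<and> \<Sigma> \<in> carrier_mat n n \<and> V \<in> carrier_mat n n \<and>
     transpose_mat U * U = 1\<^sub>m n \<and>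
     transpose_mat V * V = 1\<^sub>m n \<and> V * transpose_mat V = 1\<^sub>m n \<and>
     diagonal_mat \<Sigma> \<and> (\<forall>i<n. \<Sigma> $$ (i, i) \<ge> 0) \<and>
     A = U * \<Sigma> * transpose_mat V"

end

(* The columns of C Q give the combinations of the basis functions with coefficients in Q, and
   Q2 = V2 Sigma^-1 has the inverse Sigma V2^T, so the new family spans the same space and is again
   a basis.  The Vandermonde matrix changes by the same right multiplication, and
   V' Q2 = U2 Sigma V2^T V2 Sigma^-1 = U2 has orthonormal columns. *)

theory Submission
  imports Defs
begin

text \<open>The sum form, unlike the scalar product of a row and a column, can be interchanged with
  other finite sums. Several later simplifications delete \<open>index_mult_mat\<close> so that it
  does not rewrite the product entry first.\<close>

lemma index_mult_mat_eq_sum: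
  assumes "A \<in> carrier_mat nr n" "B \<in> carrier_mat n nc" "i < nr" "j < nc"
  shows "(A * B) $$ (i, j) = (\<Sum>k<n. A $$ (i, k) * B $$ (k, j))"
  using assms by (auto simp: scalar_prod_def lessThan_atLeast0)

lemma sum_scaleR_fun_apply:
  fixes f :: "'i \<Rightarrow> 'a \<Rightarrow> 'b::real_vector"
  shows "(\<Sum>k\<in>S. c k *\<^sub>R f k) x = (\<Sum>k\<in>S. c k *\<^sub>R f k x)"
  by (induction S rule: infinite_finite_induct) (simp_all add: scaleR_fun_def)

text \<open>A counting argument: a maximal independent subset \<open>B0\<close> of the new vectors
  still spans \<open>S\<close>, so by Steinitz exchange it has at least \<open>n\<close> elements.
  The image of \<open>n\<close> indices has at most \<open>n\<close>, hence \<open>B0\<close> is the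
  whole image and no two indices share a vector.\<close>

lemma basis_family_if_span_eq:
  fixes b b' :: "nat \<Rightarrow> 'a::real_vector"
  assumes b: "basis_family n b S" and sp: "span (b' ` {..<n}) = S"
  shows "basis_family n b' S"
proof -
  obtain B0 where B0: "B0 \<subseteq> b' ` {..<n}" "independent B0" "b' ` {..<n} \<subseteq> span B0"
    using real_vector.maximal_independent_subset by metis
  have fin: "finite B0" using B0(1) finite_surj by blast
  have "b ` {..<n} \<subseteq> span (b ` {..<n})" by (rule real_vector.span_superset)
  also have "\<dots> = span (b' ` {..<n})" using b sp by (simp add: basis_family_def)
  also have "\<dots> \<subseteq> span B0"
    using B0(3) by (rule real_vector.span_minimal) (rule real_vector.subspace_span)
  finally have sub: "b ` {..<n} \<subseteq> span B0" .
  have "n = card (b ` {..<n})"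
    using b by (simp add: basis_family_def card_image)
  also have "\<dots> \<le> card B0"
    using real_vector.independent_span_bound[OF fin _ sub] b by (simp add: basis_family_def)
  finally have n: "n \<le> card B0" .
  have le: "card (b' ` {..<n}) \<le> n" using card_image_le[of "{..<n}" b'] by simp
  have B0_eq: "B0 = b' ` {..<n}"
    using card_seteq[OF _ B0(1)] n le by simp
  then have "inj_on b' {..<n}"
    using n le by (intro eq_card_imp_inj_on) auto
  with B0_eq B0(2) sp show ?thesis by (simp add: basis_family_def)
qed

text \<open>Since \<open>Q * P\<close> is the identity, the coefficients in \<open>P\<close> recover
  the old vectors from the new ones, so both families have the same span. Independence and
  injectivity then come from the counting lemma.\<close>

lemma basis_family_change:
  fixes b :: "nat \<Rightarrow> 'a::real_vector"
  assumes b: "basis_family n b S"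
    and Q: "Q \<in> carrier_mat n n" and P: "P \<in> carrier_mat n n" and QP: "Q * P = 1\<^sub>m n"
    and b': "\<And>j. j < n \<Longrightarrow> b' j = (\<Sum>k<n. Q $$ (k, j) *\<^sub>R b k)"
  shows "basis_family n b' S"
proof (rule basis_family_if_span_eq[OF b])
  have inv: "b i = (\<Sum>j<n. P $$ (j, i) *\<^sub>R b' j)" if i: "i < n" for i
  proof -
    have "(\<Sum>j<n. P $$ (j, i) *\<^sub>R b' j) = (\<Sum>j<n. \<Sum>k<n. (Q $$ (k, j) * P $$ (j, i)) *\<^sub>R b k)"
      by (simp add: b' scaleR_sum_right mult.commute)
    also have "\<dots> = (\<Sum>k<n. (Q * P) $$ (k, i) *\<^sub>R b k)"
      by (subst sum.swap)
        (simp add: index_mult_mat_eq_sum[OF Q P] i scaleR_sum_left del: index_mult_mat)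
    also have "\<dots> = (\<Sum>k<n. if k = i then b k else 0)"
      using i by (intro sum.cong) (auto simp: QP)
    finally show ?thesis using i by simp
  qed
  have "span (b' ` {..<n}) = span (b ` {..<n})"
  proof (rule real_vector.span_eq[THEN iffD2], intro conjI image_subsetI)
    fix j assume "j \<in> {..<n}"
    then have "b' j = (\<Sum>k<n. Q $$ (k, j) *\<^sub>R b k)" by (simp add: b')
    also have "\<dots> \<in> span (b ` {..<n})"
      by (intro real_vector.span_sum real_vector.span_scale real_vector.span_base imageI)
    finally show "b' j \<in> span (b ` {..<n})" .
  next
    fix i assume "i \<in> {..<n}"
    then have "b i = (\<Sum>j<n. P $$ (j, i) *\<^sub>R b' j)" by (simp only: inv lessThan_iff)
    also have "\<dots> \<in> span (b' ` {..<n})"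
      by (intro real_vector.span_sum real_vector.span_scale real_vector.span_base imageI)
    finally show "b i \<in> span (b' ` {..<n})" .
  qed
  then show "span (b' ` {..<n}) = S" using b by (simp add: basis_family_def)
qed

text \<open>An interchange of two finite sums. With \<open>R i\<close> the value of a basis
  polynomial at a point, it serves both the minus and the plus piece.\<close>

lemma sum_mult_mat_combination:
  fixes R :: "nat \<Rightarrow> real"
  assumes "C \<in> carrier_mat l n" "Q \<in> carrier_mat n nc" "j < nc"
  shows "(\<Sum>i<l. (C * Q) $$ (i, j) * R i) = (\<Sum>k<n. Q $$ (k, j) * (\<Sum>i<l. C $$ (i, k) * R i))"
proof -
  have "(\<Sum>i<l. (C * Q) $$ (i, j) * R i) = (\<Sum>i<l. \<Sum>k<n. C $$ (i, k) * Q $$ (k, j) * R i)"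
    using assms by (simp add: index_mult_mat_eq_sum sum_distrib_right del: index_mult_mat)
  then show ?thesis
    by (subst (asm) sum.swap) (simp add: sum_distrib_left mult_ac)
qed

lemma B_family_mult:
  assumes "Cm \<in> carrier_mat ((m + 1)\<^sup>2) n" "Cp \<in> carrier_mat ((m + 1)\<^sup>2) n"
    and "Q \<in> carrier_mat n nc" "j < nc"
  shows "fst (B_family m \<eta>h \<xi>0 \<xi>1 (Cm * Q, Cp * Q) j) p =
      (\<Sum>k<n. Q $$ (k, j) * fst (B_family m \<eta>h \<xi>0 \<xi>1 (Cm, Cp) k) p)"
    and "snd (B_family m \<eta>h \<xi>0 \<xi>1 (Cm * Q, Cp * Q) j) p =
      (\<Sum>k<n. Q $$ (k, j) * snd (B_family m \<eta>h \<xi>0 \<xi>1 (Cm, Cp) k) p)"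
  unfolding B_family_def fst_conv snd_conv using assms
  by (simp_all only: sum_mult_mat_combination)

text \<open>Gluing is linear, because the point alone decides which piece is taken, and both pieces
  are combined with the same \<open>Q\<close>. The new functions thus lie in the span of the old
  ones, so the interface conditions need not be checked again.\<close>

lemma glue_B_family_mult:
  assumes "Cm \<in> carrier_mat ((m + 1)\<^sup>2) n" "Cp \<in> carrier_mat ((m + 1)\<^sup>2) n"
    and "Q \<in> carrier_mat n nc" "j < nc"
  shows "glue S (B_family m \<eta>h \<xi>0 \<xi>1 (Cm * Q, Cp * Q) j) =
    (\<Sum>k<n. Q $$ (k, j) *\<^sub>R glue S (B_family m \<eta>h \<xi>0 \<xi>1 (Cm, Cp) k))"
  using B_family_mult[OF assms]
  by (simp add: fun_eq_iff sum_scaleR_fun_apply glue_def case_prod_beta)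

text \<open>The piece used at a node depends on the node's index and not on the sign of its first
  coordinate, so each row is linear in the pieces even for nodes on the interface.\<close>

lemma vandermonde_mult:
  assumes "Cm \<in> carrier_mat ((m + 1)\<^sup>2) n" "Cp \<in> carrier_mat ((m + 1)\<^sup>2) n"
    and Q: "Q \<in> carrier_mat n nc"
  shows "vandermonde nc Nm Np xh (B_family m \<eta>h \<xi>0 \<xi>1 (Cm * Q, Cp * Q)) =
    vandermonde n Nm Np xh (B_family m \<eta>h \<xi>0 \<xi>1 (Cm, Cp)) * Q" (is "?L = ?V * Q")
proof (rule eq_matI)
  have V: "?V \<in> carrier_mat (Nm + Np) n" by (simp add: vandermonde_def)
  fix r j assume "r < dim_row (?V * Q)" "j < dim_col (?V * Q)"
  then have rj: "r < Nm + Np" "j < nc" using V Q by auto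
  show "?L $$ (r, j) = (?V * Q) $$ (r, j)"
    unfolding index_mult_mat_eq_sum[OF V Q rj]
    using rj B_family_mult[OF assms rj(2)]
    by (simp add: vandermonde_def node_value_def mult.commute)
qed (use Q in \<open>auto simp: vandermonde_def\<close>)

lemma mass_matrix_eq:
  "mass_matrix n Nm Np xh w B =
    transpose_mat (vandermonde n Nm Np xh B) * mat_diag (Nm + Np) w * vandermonde n Nm Np xh B"
  (is "_ = transpose_mat ?V * ?W * ?V")
proof (rule eq_matI)
  have V: "?V \<in> carrier_mat (Nm + Np) n" by (simp add: vandermonde_def)
  have VW: "transpose_mat ?V * ?W \<in> carrier_mat n (Nm + Np)"
    using V by (simp add: mat_diag_def)
  fix i j assume "i < dim_row (transpose_mat ?V * ?W * ?V)" "j < dim_col (transpose_mat ?V * ?W * ?V)"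
  then have ij: "i < n" "j < n" using V by auto
  have "(transpose_mat ?V * ?W) $$ (i, r) = w r * ?V $$ (r, i)" if "r < Nm + Np" for r
    using that ij V mat_diag_mult_right[of "transpose_mat ?V" n "Nm + Np" w]
    by (simp add: mult.commute)
  then show "mass_matrix n Nm Np xh w B $$ (i, j) = (transpose_mat ?V * ?W * ?V) $$ (i, j)"
    unfolding index_mult_mat_eq_sum[OF VW V ij]
    using ij by (simp add: mass_matrix_def vandermonde_def del: index_mult_mat)
qed (auto simp: mass_matrix_def vandermonde_def)

text \<open>The weight matrix is the square of a symmetric matrix \<open>?D\<close>, one factor of
  which moves into the transpose.\<close>

lemma gram_sqrt_weights:
  fixes V :: "real mat"
  assumes V: "V \<in> carrier_mat N n" and w: "\<And>r. r < N \<Longrightarrow> w r \<ge> 0"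
  shows "transpose_mat V * mat_diag N w * V =
    transpose_mat (mat_diag N (\<lambda>r. sqrt (w r)) * V) * (mat_diag N (\<lambda>r. sqrt (w r)) * V)"
proof -
  let ?D = "mat_diag N (\<lambda>r. sqrt (w r))"
  have D: "?D \<in> carrier_mat N N" by (simp add: mat_diag_def)
  \<comment> \<open>Nonnegativity matters here: \<open>sqrt\<close> is extended as an odd function,
    so the square of \<open>sqrt (w r)\<close> is in general the absolute value of
    \<open>w r\<close>.\<close>
  have DD: "?D * ?D = mat_diag N w"
    unfolding mat_diag_diag using w by (intro eq_matI) (auto simp: mat_diag_def)
  have DT: "transpose_mat ?D = ?D"
    by (rule eq_matI) (auto simp: mat_diag_def)
  have VT: "transpose_mat V \<in> carrier_mat n N" using V by simp
  have "transpose_mat (?D * V) * (?D * V) = (transpose_mat V * ?D) * (?D * V)"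
    by (simp add: transpose_mult[OF D V] DT)
  also have "\<dots> = ((transpose_mat V * ?D) * ?D) * V"
    using assoc_mult_mat[OF mult_carrier_mat[OF VT D] D V] by simp
  also have "\<dots> = transpose_mat V * mat_diag N w * V"
    by (simp only: assoc_mult_mat[OF VT D D] DD)
  finally show ?thesis by simp
qed

theorem mainTheorem2:
  fixes g :: "real \<Rightarrow> real \<times> real" and \<xi>s \<xi>e \<epsilon> h \<xi>0 \<xi>1 \<eta>h \<beta>m \<beta>p :: real
    and I :: "real set" and A :: "nat \<Rightarrow> real \<times> real" and K :: "(real \<times> real) set"
    and m n Nm Np :: nat and xm xp x xh :: "nat \<Rightarrow> real \<times> real" and wm wp w :: "nat \<Rightarrow> real"
    and Cm Cp W sqrtW V V' U2 \<Sigma> \<Sigma>inv V2 Q2 :: "real mat"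
    and \<V> :: "(real \<times> real \<Rightarrow> real) set" and B :: "real mat \<times> real mat \<Rightarrow> nat \<Rightarrow> pieces"
    and Mq :: "(nat \<Rightarrow> pieces) \<Rightarrow> real mat"
  \<comment> \<open>interface\<close>
  assumes "I = {\<xi>s..\<xi>e}" and "regular_C3_curve \<xi>s \<xi>e g"
    and "\<epsilon> > 0" and "inj_on (P_map I g) ({-\<epsilon>..\<epsilon>} \<times> I)"
    and "\<beta>m > 0" and "\<beta>p > 0"
  \<comment> \<open>interface element\<close>
    and "rectangle_vertices A" and "K = convex hull (A ` {1..4})" and "h = diameter K"
    and "interior K \<inter> g ` I \<noteq> {}"
    and "K \<subseteq> P_map I g ` ({-\<epsilon>..\<epsilon>} \<times> I)"
    and "\<xi>0 = Min ((\<lambda>i. snd (R_map \<epsilon> I g (A i))) ` {1..4})"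
    and "\<xi>1 = Max ((\<lambda>i. snd (R_map \<epsilon> I g (A i))) ` {1..4})"
    and "\<eta>h = Max ((\<lambda>i. \<bar>fst (R_map \<epsilon> I g (A i))\<bar>) ` {1..4})"
    and "{\<xi>0..\<xi>1} \<subseteq> I"
    and "inj_on (P_map I g) (Khat h \<xi>0 \<xi>1)" and "K \<subseteq> P_map I g ` Khat h \<xi>0 \<xi>1"
  \<comment> \<open>the space and a basis of it\<close>
    and "m \<ge> 1" and "n = (m + 1)\<^sup>2"
    and "\<V> = ife_space I g \<beta>m \<beta>p m h \<xi>0 \<xi>1" and "B = B_family m \<eta>h \<xi>0 \<xi>1"
    and "Cm \<in> carrier_mat n n" and "Cp \<in> carrier_mat n n"
    and "basis_family n (\<lambda>j. glue (Khat h \<xi>0 \<xi>1) (B (Cm, Cp) j)) \<V>"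
  \<comment> \<open>quadrature rules\<close>
    and "\<forall>k<Nm. xm k \<in> closure (K \<inter> P_map I g ` Khat_minus h \<xi>0 \<xi>1) \<and> wm k \<ge> 0"
    and "\<forall>k<Np. xp k \<in> closure (K \<inter> P_map I g ` Khat_plus h \<xi>0 \<xi>1) \<and> wp k \<ge> 0"
    and "x = rule_union Nm xm xp" and "w = rule_union Nm wm wp" and "xh = (\<lambda>r. R_map \<epsilon> I g (x r))"
    and "Mq = mass_matrix n Nm Np xh w"
    and "Nm + Np \<ge> n"
  \<comment> \<open>matrices and singular value decomposition\<close>
    and "W = mat_diag (Nm + Np) w" and "sqrtW = mat_diag (Nm + Np) (\<lambda>r. sqrt (w r))"
    and "V = vandermonde n Nm Np xh (B (Cm, Cp))" and "V' = sqrtW * V"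
    and "economy_svd (Nm + Np) n V' U2 \<Sigma> V2"
    and "\<Sigma>inv \<in> carrier_mat n n" and "inverts_mat \<Sigma> \<Sigma>inv" and "inverts_mat \<Sigma>inv \<Sigma>"
    and "Q2 = V2 * \<Sigma>inv"
  shows "Mq (B (Cm, Cp)) = transpose_mat V * W * V \<and>
    transpose_mat V * W * V = transpose_mat V' * V' \<and>
    basis_family n (\<lambda>j. glue (Khat h \<xi>0 \<xi>1) (B (Cm * Q2, Cp * Q2) j)) \<V> \<and>
    Mq (B (Cm * Q2, Cp * Q2)) = transpose_mat Q2 * Mq (B (Cm, Cp)) * Q2 \<and>
    transpose_mat Q2 * Mq (B (Cm, Cp)) * Q2 = 1\<^sub>m n"
proof -
  let ?N = "Nm + Np"
  have carr: "V' \<in> carrier_mat ?N n" "U2 \<in> carrier_mat ?N n" "\<Sigma> \<in> carrier_mat n n"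
      "V2 \<in> carrier_mat n n" "transpose_mat V2 \<in> carrier_mat n n"
    and UU: "transpose_mat U2 * U2 = 1\<^sub>m n"
    and VV: "transpose_mat V2 * V2 = 1\<^sub>m n" "V2 * transpose_mat V2 = 1\<^sub>m n"
    and svd: "V' = U2 * \<Sigma> * transpose_mat V2"
    using \<open>economy_svd ?N n V' U2 \<Sigma> V2\<close> by (auto simp: economy_svd_def)
  have S: "\<Sigma>inv \<in> carrier_mat n n" by fact
  \<comment> \<open>Invertibility of \<open>\<Sigma>\<close> is assumed: no singular value vanishes,
    or equivalently \<open>V'\<close> has full column rank.\<close>
  have SS: "\<Sigma> * \<Sigma>inv = 1\<^sub>m n" "\<Sigma>inv * \<Sigma> = 1\<^sub>m n"
    using \<open>inverts_mat \<Sigma> \<Sigma>inv\<close> \<open>inverts_mat \<Sigma>inv \<Sigma>\<close> carr S by (auto simp: inverts_mat_def)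
  have Q: "Q2 \<in> carrier_mat n n" using \<open>Q2 = V2 * \<Sigma>inv\<close> carr S by simp
  \<comment> \<open>The two-sided inverse of \<open>Q2\<close>, by orthogonality of
    \<open>V2\<close>. The product \<open>Q2 * P\<close> serves the change of basis, and
    \<open>P * Q2\<close> serves the identity \<open>V' * Q2 = U2\<close>.\<close>
  define P where "P = \<Sigma> * transpose_mat V2"
  have P: "P \<in> carrier_mat n n" using carr by (simp add: P_def)
  have "Q2 * P = V2 * (\<Sigma>inv * P)"
    using \<open>Q2 = V2 * \<Sigma>inv\<close> assoc_mult_mat[OF carr(4) S P] by simp
  also have "\<Sigma>inv * P = transpose_mat V2"
    unfolding P_def using assoc_mult_mat[OF S carr(3,5)] SS carr by simp
  finally have QP: "Q2 * P = 1\<^sub>m n" using VV by simp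
  have "P * Q2 = \<Sigma> * (transpose_mat V2 * Q2)"
    unfolding P_def using assoc_mult_mat[OF carr(3,5) Q] .
  also have "transpose_mat V2 * Q2 = \<Sigma>inv"
    using \<open>Q2 = V2 * \<Sigma>inv\<close> assoc_mult_mat[OF carr(5,4) S] VV S by simp
  finally have PQ: "P * Q2 = 1\<^sub>m n" using SS by simp
  have "V' = U2 * P"
    unfolding P_def using svd assoc_mult_mat[OF carr(2,3,5)] by simp
  then have VQ: "V' * Q2 = U2"
    using assoc_mult_mat[OF carr(2) P Q] PQ carr by simp

  \<comment> \<open>The row index runs over the basis polynomials and the column index over the
    family; the lemmas on \<open>B_family\<close> keep the two sizes apart.\<close>
  have C: "Cm \<in> carrier_mat ((m + 1)\<^sup>2) n" "Cp \<in> carrier_mat ((m + 1)\<^sup>2) n"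
    using \<open>Cm \<in> carrier_mat n n\<close> \<open>Cp \<in> carrier_mat n n\<close> \<open>n = (m + 1)\<^sup>2\<close> by auto
  have V: "V \<in> carrier_mat ?N n"
    using \<open>V = vandermonde n Nm Np xh (B (Cm, Cp))\<close> by (simp add: vandermonde_def)
  have W: "W \<in> carrier_mat ?N ?N"
    using \<open>W = mat_diag ?N w\<close> by (simp add: mat_diag_def)
  have w: "w r \<ge> 0" if "r < ?N" for r
    using that \<open>w = rule_union Nm wm wp\<close>
      \<open>\<forall>k<Nm. xm k \<in> closure (K \<inter> P_map I g ` Khat_minus h \<xi>0 \<xi>1) \<and> wm k \<ge> 0\<close>
      \<open>\<forall>k<Np. xp k \<in> closure (K \<inter> P_map I g ` Khat_plus h \<xi>0 \<xi>1) \<and> wp k \<ge> 0\<close>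
    by (auto simp: rule_union_def)

  have mass: "Mq (B (Cm, Cp)) = transpose_mat V * W * V"
    using mass_matrix_eq \<open>Mq = mass_matrix n Nm Np xh w\<close> \<open>W = mat_diag ?N w\<close>
      \<open>V = vandermonde n Nm Np xh (B (Cm, Cp))\<close> by simp
  have gram: "transpose_mat V * W * V = transpose_mat V' * V'"
    using gram_sqrt_weights[OF V w] \<open>W = mat_diag ?N w\<close>
      \<open>sqrtW = mat_diag ?N (\<lambda>r. sqrt (w r))\<close> \<open>V' = sqrtW * V\<close> by simp
  have basis: "basis_family n (\<lambda>j. glue (Khat h \<xi>0 \<xi>1) (B (Cm * Q2, Cp * Q2) j)) \<V>"
    using \<open>basis_family n (\<lambda>j. glue (Khat h \<xi>0 \<xi>1) (B (Cm, Cp) j)) \<V>\<close> Q P QP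
  proof (rule basis_family_change)
    show "glue (Khat h \<xi>0 \<xi>1) (B (Cm * Q2, Cp * Q2) j) =
        (\<Sum>k<n. Q2 $$ (k, j) *\<^sub>R glue (Khat h \<xi>0 \<xi>1) (B (Cm, Cp) k))" if "j < n" for j
      using glue_B_family_mult[OF C Q that] \<open>B = B_family m \<eta>h \<xi>0 \<xi>1\<close> by simp
  qed
  have VT: "transpose_mat V \<in> carrier_mat n ?N" and QT: "transpose_mat Q2 \<in> carrier_mat n n"
    and VT': "transpose_mat V' \<in> carrier_mat n ?N"
    using V Q carr by simp_all
  have VW: "transpose_mat V * W \<in> carrier_mat n ?N"
    using VT W by (rule mult_carrier_mat)
  \<comment> \<open>The nodes and weights do not change, so the same factorization holds with
    \<open>V * Q2\<close> for \<open>V\<close>; the rest is reassociation.\<close>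
  have "Mq (B (Cm * Q2, Cp * Q2)) = transpose_mat (V * Q2) * W * (V * Q2)"
    using mass_matrix_eq[of n Nm Np xh w] vandermonde_mult[OF C Q]
      \<open>Mq = mass_matrix n Nm Np xh w\<close> \<open>W = mat_diag ?N w\<close> \<open>B = B_family m \<eta>h \<xi>0 \<xi>1\<close>
      \<open>V = vandermonde n Nm Np xh (B (Cm, Cp))\<close> by simp
  also have "\<dots> = transpose_mat Q2 * (transpose_mat V * W) * (V * Q2)"
    by (simp add: transpose_mult[OF V Q] assoc_mult_mat[OF QT VT W])
  also have "\<dots> = transpose_mat Q2 * (transpose_mat V * W) * V * Q2"
    using assoc_mult_mat[OF mult_carrier_mat[OF QT VW] V Q] by simp
  also have "\<dots> = transpose_mat Q2 * Mq (B (Cm, Cp)) * Q2"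
    by (simp add: mass assoc_mult_mat[OF QT VW V])
  finally have mass': "Mq (B (Cm * Q2, Cp * Q2)) = transpose_mat Q2 * Mq (B (Cm, Cp)) * Q2" .
  \<comment> \<open>Passing to \<open>V'\<close> absorbs the weights, which makes the product the
    Gram matrix of \<open>V' * Q2\<close>, that is, of \<open>U2\<close>.\<close>
  have "transpose_mat Q2 * Mq (B (Cm, Cp)) * Q2 = transpose_mat Q2 * transpose_mat V' * V' * Q2"
    by (simp add: mass gram assoc_mult_mat[OF QT VT' carr(1)])
  also have "\<dots> = transpose_mat (V' * Q2) * (V' * Q2)"
    using assoc_mult_mat[OF mult_carrier_mat[OF QT VT'] carr(1) Q]
    by (simp add: transpose_mult[OF carr(1) Q])
  finally have "transpose_mat Q2 * Mq (B (Cm, Cp)) * Q2 = 1\<^sub>m n" by (simp add: VQ UU)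
  with mass gram basis mass' show ?thesis by blast
qed

end
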